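(* Let $K_{m,n}$ be the complete bipartite graph with partite sets $R$ of order $m$ and $R'$ of order $n$. Suppose that at the start of a round of probabilistic zero forcing the state is $(a,b)$, i.e., exactly $a$ vertices of $R$ and exactly $b$ vertices of $R'$ are blue. Then for integers $0\le k\le m-a$ and $0\le \ell\le n-b$, the probability that in this round exactly $k$ (white) vertices in $R$ and exactly $\ell$ (white) vertices in $R'$ are forced is \[ \binom{n-b}{\ell}\left(1-\left(1-\tfrac{b+1}{n}\right)^a\right)^{\ell}\left(1-\tfrac{b+1}{n}\right)^{a(n-b-\ell)} \binom{m-a}{k}\left(1-\left(1-\tfrac{a+1}{m}\right)^b\right)^{k}\left(1-\tfrac{a+1}{m}\right)^{b(m-a-k)}, \] where we define $0^0=1$.
   Context: Graphs are finite, simple and undirected. $N[u]=N(u)\cup\{u\}$ is the closed neighborhood of $u$. Probabilistic zero forcing: each vertex of a connected graph $G$ is blue or white. In one round, with $C$ the set of vertices that are blue at the start of the round, every blue vertex $u$ attempts to force each of its white neighbors $w$, all attempts being independent, each succeeding with probability $\Pr(u\to w)=\frac{|N[u]\cap C|}{\deg u}$. A white vertex becomes blue in the round (is forced) if at least one blue neighbor succeeds in forcing it; blue vertices stay blue. Here $m,n$ are positive integers. *)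

theory Defs
  imports "HOL-Probability.Probability" "Graph_Theory.Graph_Theory"
begin

text \<open>A finite simple undirected graph is a \<^locale>\<open>pair_graph\<close>: a finite loopless digraph whose arc
  relation is symmetric.  Each undirected edge is thus represented by two opposite arcs, so the
  degree of a vertex is its out-degree.\<close>

definition nbhd :: "'a pair_pre_digraph \<Rightarrow> 'a \<Rightarrow> 'a set" where
  "nbhd G u = {w. (u, w) \<in> parcs G}"

definition closed_nbhd :: "'a pair_pre_digraph \<Rightarrow> 'a \<Rightarrow> 'a set" where
  "closed_nbhd G u = insert u (nbhd G u)"

lemma (in pair_graph) card_nbhd: "card (nbhd G u) = out_degree G u"
proof -
  have "out_arcs G u = Pair u ` nbhd G u"
    by (auto simp: nbhd_def out_arcs_def)
  then show ?thesis
    by (simp add: out_degree_def card_image inj_on_def)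
qed

definition pzf_prob :: "'a pair_pre_digraph \<Rightarrow> 'a set \<Rightarrow> 'a \<Rightarrow> real" where
  "pzf_prob G C u = real (card (closed_nbhd G u \<inter> C)) / real (out_degree G u)"

definition pzf_attempts :: "'a pair_pre_digraph \<Rightarrow> 'a set \<Rightarrow> ('a \<times> 'a) set" where
  "pzf_attempts G C = {(u, w) \<in> parcs G. u \<in> C \<and> w \<notin> C}"

text \<open>\<^const>\<open>bernoulli_pmf\<close> truncates its parameter to the unit interval.  This never takes effect
  below, since a vertex making an attempt has a white neighbor.\<close>

lemma (in pair_graph) pzf_prob_in_unit_interval:
  assumes "(u, w) \<in> pzf_attempts G C"
  shows "pzf_prob G C u \<in> {0..1}"
proof -
  have fin: "finite (nbhd G u)"
    by (rule finite_subset[OF _ pair_finite_verts]) (auto simp: nbhd_def intro: in_arcsD2)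
  have w: "w \<in> nbhd G u" "w \<notin> C" "u \<in> C"
    using assms by (auto simp: pzf_attempts_def nbhd_def)
  have "card (closed_nbhd G u \<inter> C) \<le> card (insert u (nbhd G u - {w}))"
    using fin w by (intro card_mono) (auto simp: closed_nbhd_def)
  also have "\<dots> \<le> Suc (card (nbhd G u - {w}))"
    by (rule card_insert_le_m1) auto
  also have "\<dots> = card (nbhd G u)"
    using fin w by (metis card_Suc_Diff1)
  finally show ?thesis
    by (auto simp: pzf_prob_def card_nbhd divide_le_eq_1)
qed

text \<open>The distribution of the blue set at the end of a round that starts with blue set \<open>C\<close>.  The
  product distribution assigns to every attempt \<open>(u, w)\<close>, independently, whether it succeeds.\<close>

definition pzf_round :: "'a pair_pre_digraph \<Rightarrow> 'a set \<Rightarrow> 'a set pmf" where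
  "pzf_round G C =
     map_pmf (\<lambda>success. C \<union> {w. \<exists>u. (u, w) \<in> pzf_attempts G C \<and> success (u, w)})
       (Pi_pmf (pzf_attempts G C) False (\<lambda>(u, w). bernoulli_pmf (pzf_prob G C u)))"

definition complete_bipartite_on :: "'a pair_pre_digraph \<Rightarrow> 'a set \<Rightarrow> 'a set \<Rightarrow> bool" where
  "complete_bipartite_on G R R' \<longleftrightarrow>
     pair_graph G \<and> pverts G = R \<union> R' \<and> R \<inter> R' = {} \<and> parcs G = R \<times> R' \<union> R' \<times> R"

lemma complete_bipartite_on_imp_complete_bipartite_digraph:
  assumes "complete_bipartite_on G R R'"
  shows "complete_bipartite_digraph (card R) (card R') (with_proj G)"
proof -
  interpret pair_graph G
    using assms by (simp add: complete_bipartite_on_def)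
  show ?thesis
    using assms pair_finite_verts
    unfolding complete_bipartite_digraph_pair_def complete_bipartite_on_def by blast
qed

lemma complete_bipartite_on_exists:
  assumes "finite R" "finite R'" "R \<inter> R' = {}"
  shows "complete_bipartite_on \<lparr>pverts = R \<union> R', parcs = R \<times> R' \<union> R' \<times> R\<rparr> R R'"
  unfolding complete_bipartite_on_def
proof (intro conjI)
  show "pair_graph \<lparr>pverts = R \<union> R', parcs = R \<times> R' \<union> R' \<times> R\<rparr>"
    using assms by unfold_locales (auto intro!: symI simp: symmetric_def)
qed (use assms in auto)

end

theory Submission
  imports Defs
begin

text \<open>Attempts made by blue vertices of \<open>R\<close> and those made by blue vertices of \<open>R'\<close> are disjoint
  independent families.  Within one family all attempts have the same success probability, and
  distinct white targets depend on disjoint sets of attempts, so the number of forced targets is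
  binomially distributed.\<close>

text \<open>A sample on \<open>A \<union> B\<close> is obtained by gluing independent samples on
  \<open>A\<close> and on \<open>B\<close>. Since \<open>f\<close> reads only coordinates in
  \<open>A\<close> and \<open>g\<close> only those in \<open>B\<close>, each sees just its own
  sample, which makes the two results independent.\<close>

lemma map_Pi_pmf_union:
  assumes "finite A" "finite B" "A \<inter> B = {}"
    and f: "\<And>s t. (\<And>x. x \<in> A \<Longrightarrow> s x = t x) \<Longrightarrow> f s = f t"
    and g: "\<And>s t. (\<And>x. x \<in> B \<Longrightarrow> s x = t x) \<Longrightarrow> g s = g t"
  shows "map_pmf (\<lambda>s. (f s, g s)) (Pi_pmf (A \<union> B) dflt p) =
    pair_pmf (map_pmf f (Pi_pmf A dflt p)) (map_pmf g (Pi_pmf B dflt p))"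
proof -
  have "f (\<lambda>x. if x \<in> A then s x else t x) = f s" "g (\<lambda>x. if x \<in> A then s x else t x) = g t"
    for s t
    using assms(3) by (auto intro!: f g)
  then show ?thesis
    unfolding Pi_pmf_union[OF assms(1-3)] map_pair[symmetric]
    by (simp add: map_pmf_comp case_prod_beta')
qed

text \<open>Pass to the complement: no trial succeeds exactly when all \<open>card A\<close>
  independent trials fail, which has probability \<open>(1 - q) ^ card A\<close>.\<close>

lemma bernoulli_pmf_disj:
  assumes "finite A" and q: "q \<in> {0..1}"
  shows "map_pmf (\<lambda>s. \<exists>x\<in>A. s x) (Pi_pmf A dflt (\<lambda>_. bernoulli_pmf q)) =
    bernoulli_pmf (1 - (1 - q) ^ card A)" (is "?M = ?N")
proof -
  have pow: "(1 - q) ^ card A \<in> {0..1}"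
    using q by (auto intro: power_le_one)
  have "pmf ?M False = measure_pmf.prob (Pi_pmf A dflt (\<lambda>_. bernoulli_pmf q)) (Pi A (\<lambda>_. {False}))"
    unfolding pmf_map by (rule arg_cong[where f = "measure_pmf.prob _"]) auto
  also have "\<dots> = (1 - q) ^ card A"
    using q by (simp add: measure_Pi_pmf_Pi[OF assms(1)] measure_pmf_single)
  finally have F: "pmf ?M False = pmf ?N False"
    using pow by simp
  \<comment> \<open>A distribution on \<open>bool\<close> is determined by its mass at
    \<open>False\<close>.\<close>
  have T: "pmf N True = 1 - pmf N False" for N :: "bool pmf"
    using sum_pmf_eq_1[OF finite subset_UNIV, of N] by (simp add: UNIV_bool)
  show ?thesis
  proof (rule pmf_eqI)
    show "pmf ?M b = pmf ?N b" for b
      by (cases b) (simp_all only: F T)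
  qed
qed

text \<open>Induction on \<open>W\<close>: a new target \<open>w\<close> depends only on the column
  \<open>U \<times> {w}\<close>, which is disjoint from \<open>U \<times> W\<close>. Whether
  \<open>w\<close> is hit is therefore a Bernoulli variable independent of the earlier
  count.\<close>

lemma binomial_pmf_card_hit:
  assumes U: "finite U" and "finite W" and q: "q \<in> {0..1}"
  shows "map_pmf (\<lambda>s. card {w \<in> W. \<exists>u\<in>U. s (u, w)}) (Pi_pmf (U \<times> W) dflt (\<lambda>_. bernoulli_pmf q)) =
    binomial_pmf (card W) (1 - (1 - q) ^ card U)"
  using assms(2)
proof (induction rule: finite_induct)
  case empty
  show ?case
    using q by (simp add: binomial_pmf_0 power_le_one)
next
  case (insert w W)
  let ?p = "1 - (1 - q) ^ card U" and ?B = "\<lambda>_ :: 'a \<times> 'b. bernoulli_pmf q"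
  let ?hit = "\<lambda>s. \<exists>x\<in>U \<times> {w}. s x" and ?count = "\<lambda>s. card {w \<in> W. \<exists>u\<in>U. s (u, w)}"
  have p: "?p \<in> {0..1}"
    using q by (auto intro: power_le_one)
  have split: "U \<times> insert w W = U \<times> {w} \<union> U \<times> W"
    by auto
  have "{w' \<in> insert w W. \<exists>u\<in>U. s (u, w')} =
      (if ?hit s then {w} else {}) \<union> {w \<in> W. \<exists>u\<in>U. s (u, w)}" for s
    by auto
  then have card: "card {w' \<in> insert w W. \<exists>u\<in>U. s (u, w')} = (if ?hit s then 1 else 0) + ?count s" for s
    using insert.hyps by simp
  have "map_pmf (\<lambda>s. card {w' \<in> insert w W. \<exists>u\<in>U. s (u, w')}) (Pi_pmf (U \<times> insert w W) dflt ?B) =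
      map_pmf (\<lambda>(b, k). (if b then 1 else 0) + k)
        (map_pmf (\<lambda>s. (?hit s, ?count s)) (Pi_pmf (U \<times> {w} \<union> U \<times> W) dflt ?B))"
    unfolding split card by (simp only: map_pmf_comp case_prod_conv)
  also have "map_pmf (\<lambda>s. (?hit s, ?count s)) (Pi_pmf (U \<times> {w} \<union> U \<times> W) dflt ?B) =
      pair_pmf (map_pmf ?hit (Pi_pmf (U \<times> {w}) dflt ?B)) (map_pmf ?count (Pi_pmf (U \<times> W) dflt ?B))"
    using U insert.hyps
    by (intro map_Pi_pmf_union) (auto intro!: arg_cong[where f = card])
  also have "\<dots> = pair_pmf (bernoulli_pmf ?p) (binomial_pmf (card W) ?p)"
    using U q by (simp only: insert.IH bernoulli_pmf_disj finite_cartesian_product finite.intros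
      card_cartesian_product) simp
  \<comment> \<open>Adding one independent Bernoulli variable to the count is the recursion that
    defines the binomial distribution.\<close>
  also have "map_pmf (\<lambda>(b, k). (if b then 1 else 0) + k) \<dots> = binomial_pmf (Suc (card W)) ?p"
    using p by (simp add: binomial_pmf_Suc pair_pmf_def map_bind_pmf)
  finally show ?case
    using insert.hyps by simp
qed

text \<open>The bound on \<open>q\<close> is required only when some pair \<open>(u, w)\<close>
  exists, because \<open>q\<close> will be \<open>(b + 1) / n\<close>, which exceeds 1 once all of
  \<open>R'\<close> is blue, that is, when \<open>W\<close> is empty.\<close>

lemma pmf_card_hit:
  assumes "finite U" "finite W" and q: "\<And>u w. u \<in> U \<Longrightarrow> w \<in> W \<Longrightarrow> q \<in> {0..1}"
    and "j \<le> card W"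
  shows "pmf (map_pmf (\<lambda>s. card {w \<in> W. \<exists>u\<in>U. s (u, w)})
      (Pi_pmf (U \<times> W) dflt (\<lambda>_. bernoulli_pmf q))) j =
    real (card W choose j) * (1 - (1 - q) ^ card U) ^ j * (1 - q) ^ (card U * (card W - j))"
\<comment> \<open>With no pairs the count is surely 0. The formula agrees: if \<open>W\<close> is
  empty then \<open>j = 0\<close>, and if \<open>U\<close> is empty the middle factor is
  \<open>0 ^ j\<close>, where \<open>0 ^ 0 = 1\<close>.\<close>
proof (cases "U = {} \<or> W = {}")
  case True
  then show ?thesis
    using assms(4) by (auto simp: indicator_def)
next
  case False
  then have "q \<in> {0..1}"
    using q by blast
  then show ?thesis
    using assms by (subst binomial_pmf_card_hit)
      (simp_all add: power_le_one pmf_binomial power_mult)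
qed

theorem proposition2p5:
  fixes G :: "'a pair_pre_digraph" and R R' C :: "'a set" and m n a b k l :: nat
  assumes "m \<ge> 1" and "n \<ge> 1"
    and "complete_bipartite_on G R R'" and "card R = m" and "card R' = n"
    and "C \<subseteq> pverts G" and "card (R \<inter> C) = a" and "card (R' \<inter> C) = b"
    and "k \<le> m - a" and "l \<le> n - b"
  shows "measure_pmf.prob (pzf_round G C)
      {C'. card (R \<inter> (C' - C)) = k \<and> card (R' \<inter> (C' - C)) = l} =
    real ((n - b) choose l)
      * (1 - (1 - (real b + 1) / real n) ^ a) ^ l
      * (1 - (real b + 1) / real n) ^ (a * (n - b - l))
      * real ((m - a) choose k)
      * (1 - (1 - (real a + 1) / real m) ^ b) ^ k
      * (1 - (real a + 1) / real m) ^ (b * (m - a - k))"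
proof -
  interpret pair_graph G
    using assms by (simp add: complete_bipartite_on_def)
  have verts: "pverts G = R \<union> R'" and disj: "R \<inter> R' = {}" and arcs: "parcs G = R \<times> R' \<union> R' \<times> R"
    using assms by (simp_all add: complete_bipartite_on_def)
  have fin: "finite R" "finite R'"
    using pair_finite_verts verts by simp_all
  have card_white: "card (R - C) = m - a" "card (R' - C) = n - b"
    using fin assms by (simp_all add: card_Diff_subset_Int)
  let ?A = "(R \<inter> C) \<times> (R' - C)" and ?B = "(R' \<inter> C) \<times> (R - C)"
  \<comment> \<open>The summand 1 counts the blue vertex itself, which lies in its own closed
    neighborhood but on the other side from its neighbors.\<close>
  let ?q = "(real b + 1) / real n" and ?q' = "(real a + 1) / real m"
  let ?hit = "\<lambda>s. card {w \<in> R' - C. \<exists>u\<in>R \<inter> C. s (u, w)}"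
  let ?hit' = "\<lambda>s. card {w \<in> R - C. \<exists>u\<in>R' \<inter> C. s (u, w)}"
  let ?P = "\<lambda>(u, w). bernoulli_pmf (pzf_prob G C u)"
  have attempts: "pzf_attempts G C = ?A \<union> ?B"
    by (auto simp: pzf_attempts_def arcs)
  have prob: "pzf_prob G C u = ?q" if "u \<in> R \<inter> C" for u
  proof -
    have nb: "nbhd G u = R'"
      using that disj by (auto simp: nbhd_def arcs)
    have "closed_nbhd G u \<inter> C = insert u (R' \<inter> C)"
      using that nb by (auto simp: closed_nbhd_def)
    moreover have "card (insert u (R' \<inter> C)) = Suc b"
      using that disj fin assms by (subst card_insert_disjoint) auto
    ultimately show ?thesis
      using nb assms by (simp add: pzf_prob_def flip: card_nbhd)
  qed
  have prob': "pzf_prob G C u = ?q'" if "u \<in> R' \<inter> C" for u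
  proof -
    have nb: "nbhd G u = R"
      using that disj by (auto simp: nbhd_def arcs)
    have "closed_nbhd G u \<inter> C = insert u (R \<inter> C)"
      using that nb by (auto simp: closed_nbhd_def)
    moreover have "card (insert u (R \<inter> C)) = Suc a"
      using that disj fin assms by (subst card_insert_disjoint) auto
    ultimately show ?thesis
      using nb assms by (simp add: pzf_prob_def flip: card_nbhd)
  qed
  have PiA: "Pi_pmf ?A False ?P = Pi_pmf ?A False (\<lambda>_. bernoulli_pmf ?q)"
    and PiB: "Pi_pmf ?B False ?P = Pi_pmf ?B False (\<lambda>_. bernoulli_pmf ?q')"
    by (auto intro!: Pi_pmf_cong simp: prob prob')
  have q: "?q \<in> {0..1}" if "u \<in> R \<inter> C" "w \<in> R' - C" for u w
    using pzf_prob_in_unit_interval[of u w C] that unfolding attempts prob[OF that(1)] by blast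
  have q': "?q' \<in> {0..1}" if "u \<in> R' \<inter> C" "w \<in> R - C" for u w
    using pzf_prob_in_unit_interval[of u w C] that unfolding attempts prob'[OF that(1)] by blast
  have hit: "pmf (map_pmf ?hit (Pi_pmf ?A False (\<lambda>_. bernoulli_pmf ?q))) l =
      real ((n - b) choose l) * (1 - (1 - ?q) ^ a) ^ l * (1 - ?q) ^ (a * (n - b - l))"
    using pmf_card_hit[of "R \<inter> C" "R' - C" ?q l False] fin q assms(10)
    unfolding card_white assms(7) by blast
  have hit': "pmf (map_pmf ?hit' (Pi_pmf ?B False (\<lambda>_. bernoulli_pmf ?q'))) k =
      real ((m - a) choose k) * (1 - (1 - ?q') ^ b) ^ k * (1 - ?q') ^ (b * (m - a - k))"
    using pmf_card_hit[of "R' \<inter> C" "R - C" ?q' k False] fin q' assms(9)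
    unfolding card_white assms(8) by blast
  \<comment> \<open>Vertices of \<open>R\<close> can be forced only through pairs in
    \<open>?B\<close>, and vertices of \<open>R'\<close> only through pairs in \<open>?A\<close>,
    since every edge joins the two sides.\<close>
  have "R \<inter> (C \<union> {w. \<exists>u. (u, w) \<in> ?A \<union> ?B \<and> s (u, w)} - C) = {w \<in> R - C. \<exists>u\<in>R' \<inter> C. s (u, w)}"
    and "R' \<inter> (C \<union> {w. \<exists>u. (u, w) \<in> ?A \<union> ?B \<and> s (u, w)} - C) = {w \<in> R' - C. \<exists>u\<in>R \<inter> C. s (u, w)}"
    for s :: "'a \<times> 'a \<Rightarrow> bool"
    using disj by auto
  then have "measure_pmf.prob (pzf_round G C)
      {C'. card (R \<inter> (C' - C)) = k \<and> card (R' \<inter> (C' - C)) = l} =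
      measure_pmf.prob (Pi_pmf (?A \<union> ?B) False ?P) {s. ?hit' s = k \<and> ?hit s = l}"
    unfolding pzf_round_def attempts measure_map_pmf vimage_Collect_eq by simp
  \<comment> \<open>The event becomes a point mass of the joint distribution of the two counts. The
    count in \<open>R'\<close> comes first, matching the order of the factors in the claim.\<close>
  also have "\<dots> = pmf (map_pmf (\<lambda>s. (?hit s, ?hit' s)) (Pi_pmf (?A \<union> ?B) False ?P)) (l, k)"
    unfolding pmf_map by (rule arg_cong[where f = "measure_pmf.prob _"]) auto
  also have "map_pmf (\<lambda>s. (?hit s, ?hit' s)) (Pi_pmf (?A \<union> ?B) False ?P) =
      pair_pmf (map_pmf ?hit (Pi_pmf ?A False (\<lambda>_. bernoulli_pmf ?q)))
        (map_pmf ?hit' (Pi_pmf ?B False (\<lambda>_. bernoulli_pmf ?q')))"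
    \<comment> \<open>The constant families are folded back into \<open>?P\<close>, because
      splitting the product needs one common family on \<open>?A \<union> ?B\<close>.\<close>
    unfolding PiA[symmetric] PiB[symmetric] using fin disj
    by (intro map_Pi_pmf_union) (auto intro!: arg_cong[where f = card])
  also have "pmf \<dots> (l, k) =
      real ((n - b) choose l) * (1 - (1 - ?q) ^ a) ^ l * (1 - ?q) ^ (a * (n - b - l)) *
      (real ((m - a) choose k) * (1 - (1 - ?q') ^ b) ^ k * (1 - ?q') ^ (b * (m - a - k)))"
    by (simp only: pmf_pair hit hit')
  finally show ?thesis
    by (simp only: mult.assoc)
qed

end
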